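(* Let $(H,\circ)$ be an LA-semihypergroup with left identity $e$. If either $H\circ a=H$ for all $a\in H$, or $a\circ H=H$ for all $a\in H$, then $H$ is intra-regular.
   Context: A hyperoperation on a non-empty set $H$ is a map $\circ: H\times H\to \mathcal{P}(H)\setminus\{\emptyset\}$. For non-empty $A,B\subseteq H$, $A\circ B=\bigcup_{a\in A,\,b\in B}a\circ b$, and singletons are identified with their elements ($a\circ B=\{a\}\circ B$, etc.). $(H,\circ)$ is an LA-semihypergroup if $(x\circ y)\circ z=(z\circ y)\circ x$ for all $x,y,z\in H$. An element $e\in H$ is a left identity if $a\in e\circ a$ for all $a\in H$. Write $a^2=a\circ a$. $H$ is intra-regular if for every $a\in H$ there exist $x,y\in H$ with $a\in (x\circ a^2)\circ y$. *)

theory Defs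
  imports Main
begin

text \<open>A hyperoperation is a function on the whole type; only its values on the carrier matter.\<close>

definition hyperoperation :: "'a set \<Rightarrow> ('a \<Rightarrow> 'a \<Rightarrow> 'a set) \<Rightarrow> bool" where
  "hyperoperation H f \<longleftrightarrow> H \<noteq> {} \<and> (\<forall>x\<in>H. \<forall>y\<in>H. f x y \<subseteq> H \<and> f x y \<noteq> {})"

definition hyperprod :: "('a \<Rightarrow> 'a \<Rightarrow> 'a set) \<Rightarrow> 'a set \<Rightarrow> 'a set \<Rightarrow> 'a set" where
  "hyperprod f A B = (\<Union>a\<in>A. \<Union>b\<in>B. f a b)"

definition LA_semihypergroup :: "'a set \<Rightarrow> ('a \<Rightarrow> 'a \<Rightarrow> 'a set) \<Rightarrow> bool" where
  "LA_semihypergroup H f \<longleftrightarrow> hyperoperation H f \<and>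
     (\<forall>x\<in>H. \<forall>y\<in>H. \<forall>z\<in>H. hyperprod f (f x y) {z} = hyperprod f (f z y) {x})"

definition left_identity :: "'a set \<Rightarrow> ('a \<Rightarrow> 'a \<Rightarrow> 'a set) \<Rightarrow> 'a \<Rightarrow> bool" where
  "left_identity H f e \<longleftrightarrow> e \<in> H \<and> (\<forall>a\<in>H. a \<in> f e a)"

definition intra_regular :: "'a set \<Rightarrow> ('a \<Rightarrow> 'a \<Rightarrow> 'a set) \<Rightarrow> bool" where
  "intra_regular H f \<longleftrightarrow>
     (\<forall>a\<in>H. \<exists>x\<in>H. \<exists>y\<in>H. a \<in> hyperprod f (hyperprod f {x} (f a a)) {y})"

end

theory Submission
  imports Defs
begin

text \<open>The products of sets are unions, so one element \<open>b\<close> of \<open>f a a\<close>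
  may stand for all of \<open>a^2\<close>: it suffices to find \<open>x\<close>, \<open>c\<close> in
  \<open>f x b\<close> and \<open>y\<close> with \<open>a\<close> in \<open>f c y\<close>. Either
  form of the hypothesis makes equations in one unknown solvable; using it at \<open>b\<close> (left
  form) or at \<open>c\<close> (right form) yields the missing factor.\<close>

theorem theorem3:
  fixes H :: "'a set" and f :: "'a \<Rightarrow> 'a \<Rightarrow> 'a set" and e :: 'a
  assumes "LA_semihypergroup H f"
    and "left_identity H f e"
    and "(\<forall>a\<in>H. hyperprod f H {a} = H) \<or> (\<forall>a\<in>H. hyperprod f {a} H = H)"
  shows "intra_regular H f"
  unfolding intra_regular_def
proof
  fix a assume a: "a \<in> H"
  have hyp: "f x y \<subseteq> H" "f x y \<noteq> {}" if "x \<in> H" "y \<in> H" for x y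
    using assms(1) that unfolding LA_semihypergroup_def hyperoperation_def by blast+
  obtain b where b: "b \<in> f a a" "b \<in> H" using hyp[OF a a] by blast
  have "\<exists>x\<in>H. \<exists>c\<in>f x b. \<exists>y\<in>H. a \<in> f c y"
    using assms(3)
  proof
    assume left: "\<forall>a\<in>H. hyperprod f H {a} = H"
    \<comment> \<open>Solvability at \<open>a\<close> itself gives \<open>h\<close>, which serves as
      \<open>c\<close> with \<open>y = a\<close>; solving again at \<open>b\<close> factors
      \<open>h\<close> through \<open>b\<close>.\<close>
    then obtain h where h: "h \<in> H" "a \<in> f h a"
      using a unfolding hyperprod_def by blast
    obtain x where "x \<in> H" "h \<in> f x b"
      using left b(2) h(1) unfolding hyperprod_def by blast
    then show ?thesis using h a by blast
  next
    assume right: "\<forall>a\<in>H. hyperprod f {a} H = H"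
    \<comment> \<open>Here the left factor is free: \<open>x = a\<close> is just an available
      element of \<open>H\<close>, and only \<open>y\<close> has to be solved for.\<close>
    obtain c where c: "c \<in> f a b" "c \<in> H" using hyp[OF a b(2)] by blast
    obtain y where "y \<in> H" "a \<in> f c y"
      using right c(2) a unfolding hyperprod_def by blast
    then show ?thesis using a c(1) by blast
  qed
  then show "\<exists>x\<in>H. \<exists>y\<in>H. a \<in> hyperprod f (hyperprod f {x} (f a a)) {y}"
    using b(1) unfolding hyperprod_def by blast
qed

end
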